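(* Let $(G,F,\mathcal{C})$ be a framework. Then: (1) $F$ is an induced subgraph of $G$. (2) Every edge $e\in E(G)\setminus E(F)$ belongs to at least two members of $\mathcal{C}$; it belongs to more than two if and only if $e$ is an end-edge of a path in $\mathcal{C}$ and neither end of $e$ is in $V(F)$, and in this case $e$ belongs to exactly four members of $\mathcal{C}$, all of them paths, and $e$ is an end-edge of each of them. (3) For every two edges $e,f$ of $G$ with a common end that has degree three in $G\setminus E(F)$, there is at most one $C\in\mathcal{C}$ with $e,f\in E(C)$.
   Context: All graphs are finite and simple; paths and circuits have no repeated vertices. The ends of a path are its first and last vertices, its end-edges its first and last edges. For a set of edges $E'$, $G\setminus E'$ is obtained from $G$ by deleting those edges (keeping all vertices). For a path or circuit $C$, a sequence of vertices/edges is "in order" in $C$ if they are met in that order traversing $C$ (from one end if $C$ is a path; from some starting point if $C$ is a circuit). A framework is a triple $(G,F,\mathcal{C})$ where $G$ is cubic, $F$ is a subgraph of $G$, and $\mathcal{C}$ is a set of subgraphs of $G\setminus E(F)$, satisfying (F1)–(F7) below. Distinct edges $e,f$ are twinned if there exist distinct $C_1,C_2\in\mathcal{C}$ with $e,f\in E(C_1\cap C_2)$. (F1) Each member of $\mathcal{C}$ is an induced subgraph of $G\setminus E(F)$, has at least three edges, and is a path or a circuit. (F2) Every edge of $G\setminus E(F)$ belongs to some member of $\mathcal{C}$, and for every two edges $e,f$ of $G$ with a common end not in $V(F)$ there exists $C\in\mathcal{C}$ with $e,f\in E(C)$. (F3) If $C_1,C_2\in\mathcal{C}$ are distinct and $v\in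 V(C_1\cap C_2)$, then either $V(C_1\cap C_2)=\{v\}$, or $v$ is incident with an edge of $C_1\cap C_2$, or $v\in V(F)$. (F4) If $C_1\in\mathcal{C}$ is a path, every member of $\mathcal{C}$ containing an end-edge of $C_1$ is a path; and if $C_2\in\mathcal{C}\setminus\{C_1\}$ is also a path, then every component of $C_1\cap C_2$ contains an end of $C_1$, and every edge of $C_1\cap C_2$ is an end-edge of $C_1$. (F5) If $C\in\mathcal{C}$ is a circuit then $|V(C\cap F)|\le 1$ and every vertex of $C\cap F$ has degree 1 in $F$; if $C\in\mathcal{C}$ is a path then every vertex of $C\cap F$ is an end of $C$ and has degree 0 or 2 in $F$. (F6) If $e,f$ are twinned and $C\in\mathcal{C}$ with $e\in E(C)$, then $|V(C)|\le 6$ and either: $f\in E(C)$, $C$ is a circuit, $e,f$ have a common end in $V(F)$, and no path in $\mathcal{C}$ contains any vertex of $e$ or $f$; or $f\in E(C)$, $C$ is a path with end-edges $e,f$, and $C\cap F$ is null; or $f\notin E(C)$, $C$ is a path with $|E(C)|=3$, $e$ is an end-edge of $C$, and no end of $e$ is in $V(F)$. (F7) Let $C\in\mathcal{C}$ be a path of length five with twinned end-edges $e,f$. Then $|E(C')|\le 4$ for every path $C'\in\mathcal{C}\setminus\{C\}$ containing $e$. Moreover, let $C$ have vertices $v_0,v_1,\dots,v_5$ in order; then there exists $C'\in\mathcal{C}$ with end-edges $e$ and $f$ and with ends $v_0$ and $v_4$. *)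

theory Defs
  imports Main
begin

(* Simple graphs. An edge is the two-element set of its ends, so "v is an end of e" is v \<in> e
   and two distinct edges have a common end v iff v \<in> e \<inter> f. *)
record 'a graph =
  verts :: "'a set"
  edges :: "'a set set"

definition simple_graph :: "'a graph \<Rightarrow> bool" where
  "simple_graph G \<longleftrightarrow> (\<forall>e\<in>edges G. e \<subseteq> verts G \<and> card e = 2)"

definition subgraph :: "'a graph \<Rightarrow> 'a graph \<Rightarrow> bool" where
  "subgraph H G \<longleftrightarrow>
     simple_graph H \<and> simple_graph G \<and> verts H \<subseteq> verts G \<and> edges H \<subseteq> edges G"

definition induced_subgraph :: "'a graph \<Rightarrow> 'a graph \<Rightarrow> bool" where
  "induced_subgraph H G \<longleftrightarrow>
     subgraph H G \<and> (\<forall>e\<in>edges G. e \<subseteq> verts H \<longrightarrow> e \<in> edges H)"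

definition delete_edges :: "'a graph \<Rightarrow> 'a set set \<Rightarrow> 'a graph" where
  "delete_edges G E' = \<lparr>verts = verts G, edges = edges G - E'\<rparr>"

definition graph_inter :: "'a graph \<Rightarrow> 'a graph \<Rightarrow> 'a graph" where
  "graph_inter G H = \<lparr>verts = verts G \<inter> verts H, edges = edges G \<inter> edges H\<rparr>"

definition degree :: "'a graph \<Rightarrow> 'a \<Rightarrow> nat" where
  "degree G v = card {e \<in> edges G. v \<in> e}"

definition cubic :: "'a graph \<Rightarrow> bool" where
  "cubic G \<longleftrightarrow> (\<forall>v\<in>verts G. degree G v = 3)"

definition connected_graph :: "'a graph \<Rightarrow> bool" where
  "connected_graph G \<longleftrightarrow> verts G \<noteq> {} \<and>
     (\<forall>u\<in>verts G. \<forall>v\<in>verts G. (u, v) \<in> {(x, y). {x, y} \<in> edges G}\<^sup>*)"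

definition component :: "'a graph \<Rightarrow> 'a graph \<Rightarrow> bool" where
  "component K G \<longleftrightarrow> subgraph K G \<and> connected_graph K \<and>
     (\<forall>K'. subgraph K' G \<and> connected_graph K' \<and> subgraph K K' \<longrightarrow> K' = K)"

(* Paths and circuits are graphs, not sequences: path_seq P vs says that vs lists the vertices
   of the path P in order, so a path with an edge has exactly two such lists. *)
definition consecutive_edges :: "'a list \<Rightarrow> 'a set set" where
  "consecutive_edges vs = {{vs ! i, vs ! Suc i} |i. Suc i < length vs}"

definition path_seq :: "'a graph \<Rightarrow> 'a list \<Rightarrow> bool" where
  "path_seq P vs \<longleftrightarrow> vs \<noteq> [] \<and> distinct vs \<and>
     verts P = set vs \<and> edges P = consecutive_edges vs"

definition circuit_seq :: "'a graph \<Rightarrow> 'a list \<Rightarrow> bool" where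
  "circuit_seq C vs \<longleftrightarrow> length vs \<ge> 3 \<and> distinct vs \<and>
     verts C = set vs \<and> edges C = insert {last vs, hd vs} (consecutive_edges vs)"

definition is_path :: "'a graph \<Rightarrow> bool" where
  "is_path P \<longleftrightarrow> (\<exists>vs. path_seq P vs)"

definition is_circuit :: "'a graph \<Rightarrow> bool" where
  "is_circuit C \<longleftrightarrow> (\<exists>vs. circuit_seq C vs)"

definition path_ends :: "'a graph \<Rightarrow> 'a set" where
  "path_ends P = {v. \<exists>vs. path_seq P vs \<and> (v = hd vs \<or> v = last vs)}"

definition end_edges :: "'a graph \<Rightarrow> 'a set set" where
  "end_edges P = {e. \<exists>vs. path_seq P vs \<and> length vs \<ge> 2 \<and>
     (e = {vs ! 0, vs ! 1} \<or> e = {vs ! (length vs - 2), vs ! (length vs - 1)})}"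

definition twinned :: "'a graph set \<Rightarrow> 'a set \<Rightarrow> 'a set \<Rightarrow> bool" where
  "twinned \<C> e f \<longleftrightarrow> e \<noteq> f \<and>
     (\<exists>C1\<in>\<C>. \<exists>C2\<in>\<C>. C1 \<noteq> C2 \<and>
        e \<in> edges (graph_inter C1 C2) \<and> f \<in> edges (graph_inter C1 C2))"

locale framework =
  fixes G F :: "'a graph" and \<C> :: "'a graph set"
  assumes finite_G: "finite (verts G)"
    and simple_G: "simple_graph G"
    and cubic_G: "cubic G"
    and subgraph_F: "subgraph F G"
    and subgraph_C: "\<And>C. C \<in> \<C> \<Longrightarrow> subgraph C (delete_edges G (edges F))"
    and F1: "\<And>C. C \<in> \<C> \<Longrightarrow>
      induced_subgraph C (delete_edges G (edges F)) \<and> card (edges C) \<ge> 3 \<and>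
      (is_path C \<or> is_circuit C)"
    and F2_cover: "\<And>e. e \<in> edges (delete_edges G (edges F)) \<Longrightarrow> \<exists>C\<in>\<C>. e \<in> edges C"
    and F2_adjacent: "\<And>e f v. e \<in> edges G \<Longrightarrow> f \<in> edges G \<Longrightarrow> e \<noteq> f \<Longrightarrow>
      v \<in> e \<inter> f \<Longrightarrow> v \<notin> verts F \<Longrightarrow> \<exists>C\<in>\<C>. e \<in> edges C \<and> f \<in> edges C"
    and F3: "\<And>C1 C2 v. C1 \<in> \<C> \<Longrightarrow> C2 \<in> \<C> \<Longrightarrow> C1 \<noteq> C2 \<Longrightarrow>
      v \<in> verts (graph_inter C1 C2) \<Longrightarrow>
      verts (graph_inter C1 C2) = {v} \<or> (\<exists>e\<in>edges (graph_inter C1 C2). v \<in> e) \<or> v \<in> verts F"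
    and F4_end_edge: "\<And>C1 C e. C1 \<in> \<C> \<Longrightarrow> is_path C1 \<Longrightarrow> C \<in> \<C> \<Longrightarrow>
      e \<in> end_edges C1 \<Longrightarrow> e \<in> edges C \<Longrightarrow> is_path C"
    and F4_inter: "\<And>C1 C2. C1 \<in> \<C> \<Longrightarrow> is_path C1 \<Longrightarrow> C2 \<in> \<C> - {C1} \<Longrightarrow> is_path C2 \<Longrightarrow>
      (\<forall>K. component K (graph_inter C1 C2) \<longrightarrow> verts K \<inter> path_ends C1 \<noteq> {}) \<and>
      edges (graph_inter C1 C2) \<subseteq> end_edges C1"
    and F5_circuit: "\<And>C. C \<in> \<C> \<Longrightarrow> is_circuit C \<Longrightarrow>
      card (verts (graph_inter C F)) \<le> 1 \<and> (\<forall>v\<in>verts (graph_inter C F). degree F v = 1)"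
    and F5_path: "\<And>C v. C \<in> \<C> \<Longrightarrow> is_path C \<Longrightarrow> v \<in> verts (graph_inter C F) \<Longrightarrow>
      v \<in> path_ends C \<and> degree F v \<in> {0, 2}"
    and F6: "\<And>e f C. twinned \<C> e f \<Longrightarrow> C \<in> \<C> \<Longrightarrow> e \<in> edges C \<Longrightarrow>
      card (verts C) \<le> 6 \<and>
      ((f \<in> edges C \<and> is_circuit C \<and> (\<exists>v\<in>verts F. v \<in> e \<and> v \<in> f) \<and>
          (\<forall>P\<in>\<C>. is_path P \<longrightarrow> verts P \<inter> (e \<union> f) = {})) \<or>
       (f \<in> edges C \<and> is_path C \<and> end_edges C = {e, f} \<and> verts (graph_inter C F) = {}) \<or>
       (f \<notin> edges C \<and> is_path C \<and> card (edges C) = 3 \<and> e \<in> end_edges C \<and> e \<inter> verts F = {}))"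
    and F7_length: "\<And>C e f C'. C \<in> \<C> \<Longrightarrow> is_path C \<Longrightarrow> card (edges C) = 5 \<Longrightarrow>
      end_edges C = {e, f} \<Longrightarrow> twinned \<C> e f \<Longrightarrow>
      C' \<in> \<C> - {C} \<Longrightarrow> is_path C' \<Longrightarrow> e \<in> edges C' \<Longrightarrow> card (edges C') \<le> 4"
    and F7_exists: "\<And>C e f vs. C \<in> \<C> \<Longrightarrow> path_seq C vs \<Longrightarrow> card (edges C) = 5 \<Longrightarrow>
      end_edges C = {e, f} \<Longrightarrow> twinned \<C> e f \<Longrightarrow>
      \<exists>C'\<in>\<C>. is_path C' \<and> end_edges C' = {e, f} \<and> path_ends C' = {vs ! 0, vs ! 4}"

end

theory Submission
  imports Defs
begin

text \<open>An edge with both ends in \<open>V(F)\<close> but outside \<open>F\<close> would lie in a member of \<open>\<C>\<close> that is either a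
  circuit meeting \<open>F\<close> twice or a path whose two ends are adjacent along it; this gives (1). For (3), two
  members sharing adjacent edges make these twinned, and (F6) then puts the common end in \<open>V(F)\<close> with
  degree 1 in \<open>F\<close>. For (2), let \<open>v \<notin> V(F)\<close> be an end of \<open>e\<close>. By (F2) and (3), exactly two members
  contain \<open>e\<close> and turn at \<open>v\<close> into one of the other two edges there. If \<open>e\<close> is not an end-edge, or its
  other end is in \<open>V(F)\<close>, every member containing \<open>e\<close> continues past \<open>v\<close>. Otherwise (F4) forces all of
  them to be paths with end-edge \<open>e\<close>, each continuing past exactly one end of \<open>e\<close>: two past either
  end.\<close>

section \<open>Paths: the edges at a vertex, ends and end-edges\<close>

lemma doubleton_nth_eq_iff:
  assumes "distinct vs" "i < length vs" "j < length vs" "k < length vs" "l < length vs"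
  shows "{vs ! i, vs ! j} = {vs ! k, vs ! l} \<longleftrightarrow> i = k \<and> j = l \<or> i = l \<and> j = k"
  using assms by (auto simp: doubleton_eq_iff nth_eq_iff_index_eq)

lemma card_consecutive_edges_le: "card (consecutive_edges vs) \<le> length vs - 1"
proof -
  have "consecutive_edges vs = (\<lambda>i. {vs ! i, vs ! Suc i}) ` {..<length vs - 1}"
    unfolding consecutive_edges_def by force
  then show ?thesis using card_image_le[of "{..<length vs - 1}"] by simp
qed

lemma consecutive_edges_at:
  assumes "distinct vs" "i < length vs"
  shows "{d \<in> consecutive_edges vs. vs ! i \<in> d} =
    (if i = 0 then {} else {{vs ! (i - 1), vs ! i}}) \<union>
    (if Suc i < length vs then {{vs ! i, vs ! Suc i}} else {})"
proof (intro equalityI subsetI)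
  fix d assume "d \<in> {d \<in> consecutive_edges vs. vs ! i \<in> d}"
  then obtain k where k: "d = {vs ! k, vs ! Suc k}" "Suc k < length vs" "vs ! i \<in> d"
    by (auto simp: consecutive_edges_def)
  then have "i = k \<or> i = Suc k" using assms by (auto simp: nth_eq_iff_index_eq)
  with k show "d \<in> (if i = 0 then {} else {{vs ! (i - 1), vs ! i}}) \<union>
    (if Suc i < length vs then {{vs ! i, vs ! Suc i}} else {})" by auto
next
  fix d assume "d \<in> (if i = 0 then {} else {{vs ! (i - 1), vs ! i}}) \<union>
    (if Suc i < length vs then {{vs ! i, vs ! Suc i}} else {})"
  then consider "i \<noteq> 0" "d = {vs ! (i - 1), vs ! i}"
    | "Suc i < length vs" "d = {vs ! i, vs ! Suc i}"
    by (auto split: if_splits)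
  then show "d \<in> {d \<in> consecutive_edges vs. vs ! i \<in> d}"
  proof cases
    case 1
    then have "Suc (i - 1) = i" by simp
    with 1 assms show ?thesis by (force simp: consecutive_edges_def)
  qed (auto simp: consecutive_edges_def)
qed

lemma path_edges_at:
  assumes "path_seq P vs" "i < length vs"
  shows "{d \<in> edges P. vs ! i \<in> d} =
    (if i = 0 then {} else {{vs ! (i - 1), vs ! i}}) \<union>
    (if Suc i < length vs then {{vs ! i, vs ! Suc i}} else {})"
  using assms consecutive_edges_at[of vs i] unfolding path_seq_def by simp

lemma path_length:
  assumes "path_seq P vs" "card (edges P) \<ge> 3"
  shows "length vs \<ge> 4"
  using assms card_consecutive_edges_le[of vs] by (auto simp: path_seq_def)

text \<open>For an edge \<open>e\<close> of a path or circuit \<open>C\<close> and an end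
  \<open>v\<close> of \<open>e\<close>, this says that \<open>v\<close> has degree two in
  \<open>C\<close>, without choosing a listing of the vertices. Members of \<open>\<C>\<close> are
  counted by this property below.\<close>

definition continues_past :: "'a graph \<Rightarrow> 'a set \<Rightarrow> 'a \<Rightarrow> bool" where
  "continues_past C e v \<longleftrightarrow> (\<exists>d\<in>edges C. d \<noteq> e \<and> v \<in> d)"

text \<open>Each end of \<open>e\<close> is on at most one further edge of the path, and that edge
  is missing exactly when the end is the first or last entry of the list.\<close>

lemma path_continues_iff:
  assumes "path_seq P vs" "{vs ! i, vs ! Suc i} = e" "Suc i < length vs"
  shows "continues_past P e (vs ! i) \<longleftrightarrow> i \<noteq> 0"
    and "continues_past P e (vs ! Suc i) \<longleftrightarrow> Suc (Suc i) < length vs"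
proof -
  have d: "distinct vs" using assms by (simp add: path_seq_def)
  have "continues_past P e w \<longleftrightarrow> {d \<in> edges P. w \<in> d} - {e} \<noteq> {}" for w
    by (auto simp: continues_past_def)
  then show "continues_past P e (vs ! i) \<longleftrightarrow> i \<noteq> 0"
    "continues_past P e (vs ! Suc i) \<longleftrightarrow> Suc (Suc i) < length vs"
    using assms(3) doubleton_nth_eq_iff[OF d]
    by (auto simp: path_edges_at[OF assms(1)] assms(2)[symmetric])
qed

lemma path_edgeE:
  assumes "path_seq P vs" "e \<in> edges P"
  obtains i where "e = {vs ! i, vs ! Suc i}" "Suc i < length vs"
  using assms by (auto simp: path_seq_def consecutive_edges_def)

text \<open>Three edges force four vertices, so the two ends of the path cannot be adjacent along
  it.\<close>

lemma path_continues_some: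
  assumes "is_path P" "card (edges P) \<ge> 3" "{u, v} \<in> edges P"
  shows "continues_past P {u, v} u \<or> continues_past P {u, v} v"
proof -
  obtain vs where vs: "path_seq P vs" using assms(1) by (auto simp: is_path_def)
  obtain i where i: "{u, v} = {vs ! i, vs ! Suc i}" "Suc i < length vs"
    using path_edgeE[OF vs assms(3)] .
  have "length vs \<ge> 4" using path_length[OF vs assms(2)] .
  then have "continues_past P {u, v} (vs ! i) \<or> continues_past P {u, v} (vs ! Suc i)"
    using path_continues_iff[OF vs i(1)[symmetric] i(2)] by auto
  then show ?thesis using i(1) by (metis doubleton_eq_iff)
qed

text \<open>One end of an end-edge is an end of the path. Together with the previous lemma, a path
  with end-edge \<open>e\<close> continues past exactly one end of \<open>e\<close>.\<close>

lemma end_edge_not_continues_both: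
  assumes "{u, v} \<in> end_edges P" "card (edges P) \<ge> 3"
  shows "\<not> (continues_past P {u, v} u \<and> continues_past P {u, v} v)"
proof -
  obtain vs where vs: "path_seq P vs"
    "{u, v} = {vs ! 0, vs ! 1} \<or> {u, v} = {vs ! (length vs - 2), vs ! (length vs - 1)}"
    using assms(1) by (auto simp: end_edges_def)
  have len: "length vs \<ge> 4" using path_length[OF vs(1) assms(2)] .
  obtain i where i: "{vs ! i, vs ! Suc i} = {u, v}" "i = 0 \<or> Suc (Suc i) = length vs"
  proof (cases "{u, v} = {vs ! 0, vs ! 1}")
    case False
    then show ?thesis using that[of "length vs - 2"] vs(2) len
      by (simp add: numeral_2_eq_2 Suc_diff_Suc)
  qed (use that[of 0] in simp)
  have "\<not> (continues_past P {u, v} (vs ! i) \<and> continues_past P {u, v} (vs ! Suc i))"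
    using path_continues_iff[OF vs(1) i(1)] i(2) len by auto
  then show ?thesis using i(1) by (auto simp: doubleton_eq_iff)
qed

text \<open>With at least four vertices, the first pair and the last pair of the list do not
  overlap. This excludes the path case of (F6) for twinned edges with a common end.\<close>

lemma end_edges_disjoint:
  assumes "is_path P" "end_edges P = {e, f}" "card (edges P) \<ge> 3"
  shows "e \<inter> f = {}"
proof -
  obtain vs where vs: "path_seq P vs" using assms(1) by (auto simp: is_path_def)
  have d: "distinct vs" using vs by (simp add: path_seq_def)
  have len: "length vs \<ge> 4" using path_length[OF vs assms(3)] .
  let ?e = "{vs ! 0, vs ! 1}" and ?f = "{vs ! (length vs - 2), vs ! (length vs - 1)}"
  have "length vs \<ge> 2" using len by simp
  then have "?e \<in> end_edges P" "?f \<in> end_edges P"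
    unfolding end_edges_def using vs by blast+
  moreover have "vs \<noteq> []" using len by auto
  then have disj: "?e \<inter> ?f = {}"
    using nth_eq_iff_index_eq[OF d] len by (auto simp del: One_nat_def)
  \<comment> \<open>The end-edges read off this one listing are distinct members of
    \<open>{e, f}\<close>, so they exhaust it and no other listing matters.\<close>
  ultimately have "{?e, ?f} \<subseteq> {e, f}" "?e \<noteq> ?f" unfolding assms(2) by blast+
  then have "e = ?e \<and> f = ?f \<or> e = ?f \<and> f = ?e" by blast
  then show ?thesis using disj by blast
qed

text \<open>If the path stopped at an end of \<open>e\<close>, then \<open>e\<close> would be the
  first or last pair of the list, hence an end-edge.\<close>

lemma path_continues:
  assumes "is_path P" "e \<in> edges P" "e \<notin> end_edges P" "v \<in> e"
  shows "continues_past P e v"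
proof -
  obtain vs where vs: "path_seq P vs" using assms(1) by (auto simp: is_path_def)
  obtain i where i: "e = {vs ! i, vs ! Suc i}" "Suc i < length vs"
    using path_edgeE[OF vs assms(2)] .
  have "i \<noteq> 0"
  proof
    assume "i = 0"
    then have "e = {vs ! 0, vs ! 1}" "length vs \<ge> 2" using i by auto
    then show False using vs assms(3) unfolding end_edges_def by blast
  qed
  moreover have "Suc (Suc i) \<noteq> length vs"
  proof
    assume "Suc (Suc i) = length vs"
    then have "e = {vs ! (length vs - 2), vs ! (length vs - 1)}" "length vs \<ge> 2"
      using i by (auto simp flip: \<open>Suc (Suc i) = length vs\<close>)
    then show False using vs assms(3) unfolding end_edges_def by blast
  qed
  ultimately show ?thesis
    using path_continues_iff[OF vs i(1)[symmetric] i(2)] i assms(4) by auto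
qed

lemma path_end_not_continues:
  assumes "v \<in> path_ends P" "e \<in> edges P" "v \<in> e"
  shows "\<not> continues_past P e v"
proof -
  obtain vs where vs: "path_seq P vs" "v = hd vs \<or> v = last vs"
    using assms(1) by (auto simp: path_ends_def)
  have d: "distinct vs" and ne: "vs \<noteq> []" using vs by (auto simp: path_seq_def)
  obtain i where i: "e = {vs ! i, vs ! Suc i}" "Suc i < length vs"
    using path_edgeE[OF vs(1) assms(2)] .
  obtain k where k: "v = vs ! k" "k = 0 \<or> k = length vs - 1" "k < length vs"
    using vs(2) ne by (metis diff_less hd_conv_nth last_conv_nth length_greater_0_conv less_one)
  have "k = i \<or> k = Suc i"
    using assms(3) i k d by (auto simp: nth_eq_iff_index_eq)
  then show ?thesis
    using path_continues_iff[OF vs(1) i(1)[symmetric] i(2)] k i by auto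
qed

lemma path_degree_le: assumes "is_path P" shows "card {d \<in> edges P. v \<in> d} \<le> 2"
proof -
  obtain vs where vs: "path_seq P vs" using assms(1) by (auto simp: is_path_def)
  show ?thesis
  proof (cases "v \<in> set vs")
    case True
    then obtain i where "i < length vs" "v = vs ! i" by (auto simp: in_set_conv_nth)
    \<comment> \<open>At the first or last index one pair on the right is spurious
      (\<open>0 - 1 = 0\<close>, or an index out of range), which is harmless for an upper
      bound.\<close>
    then have "{d \<in> edges P. v \<in> d} \<subseteq> {{vs ! (i - 1), vs ! i}, {vs ! i, vs ! Suc i}}"
      using path_edges_at[OF vs, of i] by (auto split: if_splits)
    then have "card {d \<in> edges P. v \<in> d} \<le> card {{vs ! (i - 1), vs ! i}, {vs ! i, vs ! Suc i}}"
      by (intro card_mono) auto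
    also have "\<dots> \<le> 2" by (simp add: card_insert_if)
    finally show ?thesis .
  next
    case False
    then have "{d \<in> edges P. v \<in> d} = {}"
      using vs by (auto simp: path_seq_def consecutive_edges_def)
    then show ?thesis by (simp only: card.empty)
  qed
qed

section \<open>Circuits: exactly two edges at each vertex\<close>

lemma circuit_edges_at:
  assumes "circuit_seq C vs" "i < length vs"
  obtains a b where "a < length vs" "b < length vs" "a \<noteq> b" "a \<noteq> i" "b \<noteq> i"
    "{d \<in> edges C. vs ! i \<in> d} = {{vs ! i, vs ! a}, {vs ! i, vs ! b}}"
proof -
  have d: "distinct vs" and len: "length vs \<ge> 3"
    and E: "edges C = insert {last vs, hd vs} (consecutive_edges vs)"
    using assms by (auto simp: circuit_seq_def)
  have ends: "last vs = vs ! (length vs - 1)" "hd vs = vs ! 0"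
    using last_conv_nth[of vs] hd_conv_nth[of vs] len by fastforce+
  have at: "{d \<in> edges C. vs ! i \<in> d} =
    (if vs ! i \<in> {last vs, hd vs} then {{last vs, hd vs}} else {}) \<union>
    {d \<in> consecutive_edges vs. vs ! i \<in> d}"
    unfolding E by auto
  \<comment> \<open>The closing edge meets only the first and last positions, where it supplies the
    neighbour that the list lacks.\<close>
  have mem: "vs ! i \<in> {last vs, hd vs} \<longleftrightarrow> i = length vs - 1 \<or> i = 0"
    unfolding ends insert_iff using assms(2) len
    by (simp add: nth_eq_iff_index_eq[OF d])
      (metis d assms(2) nth_eq_iff_index_eq length_greater_0_conv list.size(3) not_numeral_le_zero)
  consider "i = 0" | "i = length vs - 1" "i \<noteq> 0" | "i \<noteq> 0" "Suc i < length vs"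
    using assms(2) by linarith
  then show ?thesis
  proof cases
    case 1
    then show ?thesis using that[of "length vs - 1" 1] len
      unfolding at mem consecutive_edges_at[OF d assms(2)] ends
      by (auto simp: insert_commute)
  next
    case 2
    \<comment> \<open>The neighbours of the last vertex are at \<open>0\<close>, across the closing
      edge, and at \<open>i - 1\<close>; length at least 3 keeps them apart.\<close>
    have "vs \<noteq> []" "length vs - Suc (Suc 0) \<noteq> length vs - Suc 0" using len by auto
    with 2 show ?thesis using that[of 0 "i - 1"] len
      unfolding at mem consecutive_edges_at[OF d assms(2)] ends
      by (auto simp: insert_commute)
  next
    case 3
    then have "vs ! i \<notin> {last vs, hd vs}" unfolding mem by auto
    then have "{d \<in> edges C. vs ! i \<in> d} = {{vs ! i, vs ! (i - 1)}, {vs ! i, vs ! Suc i}}"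
      unfolding at consecutive_edges_at[OF d assms(2)] using 3 by (simp add: insert_commute)
    then show ?thesis using that[of "i - 1" "Suc i"] 3 by simp
  qed
qed

lemma circuit_vertexE:
  assumes "circuit_seq C vs" "e \<in> edges C" "v \<in> e"
  obtains i where "i < length vs" "v = vs ! i"
proof -
  have "vs \<noteq> []" "edges C = insert {last vs, hd vs} (consecutive_edges vs)"
    using assms by (auto simp: circuit_seq_def)
  then have "v \<in> set vs" using assms(2,3) by (auto simp: consecutive_edges_def)
  then show ?thesis using that by (auto simp: in_set_conv_nth)
qed

lemma circuit_degree_le: assumes "is_circuit C" shows "card {d \<in> edges C. v \<in> d} \<le> 2"
proof (cases "{d \<in> edges C. v \<in> d} = {}")
  case False
  obtain vs where vs: "circuit_seq C vs" using assms by (auto simp: is_circuit_def)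
  from False obtain d where "d \<in> edges C" "v \<in> d" by blast
  then obtain i where i: "i < length vs" "v = vs ! i"
    using circuit_vertexE[OF vs] by blast
  obtain a b where "{d \<in> edges C. v \<in> d} = {{vs ! i, vs ! a}, {vs ! i, vs ! b}}"
    using circuit_edges_at[OF vs i(1)] unfolding i(2) by blast
  then show ?thesis by (simp only: card_insert_if) (simp add: card_insert_if)
next
  case True
  then show ?thesis by (simp only: card.empty)
qed

text \<open>Two distinct neighbours of \<open>v\<close> give two distinct edges at \<open>v\<close>,
  and at least one of them is not \<open>e\<close>.\<close>

lemma circuit_continues:
  assumes "is_circuit C" "e \<in> edges C" "v \<in> e"
  shows "continues_past C e v"
proof -
  obtain vs where vs: "circuit_seq C vs" using assms by (auto simp: is_circuit_def)
  have d: "distinct vs" using vs by (simp add: circuit_seq_def)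
  obtain i where i: "i < length vs" "v = vs ! i"
    using circuit_vertexE[OF vs assms(2,3)] .
  obtain a b where ab: "a < length vs" "b < length vs" "a \<noteq> b" "a \<noteq> i" "b \<noteq> i"
    "{d \<in> edges C. v \<in> d} = {{vs ! i, vs ! a}, {vs ! i, vs ! b}}"
    using circuit_edges_at[OF vs i(1)] unfolding i(2) by blast
  have "{vs ! i, vs ! a} \<noteq> {vs ! i, vs ! b}"
    using ab i by (simp add: doubleton_nth_eq_iff[OF d])
  moreover have "{vs ! i, vs ! a} \<in> {d \<in> edges C. v \<in> d}" "{vs ! i, vs ! b} \<in> {d \<in> edges C. v \<in> d}"
    unfolding ab(6) by simp_all
  ultimately show ?thesis unfolding continues_past_def mem_Collect_eq by metis
qed

section \<open>Frameworks: \<open>F\<close> is induced, uniqueness of members, counting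
  members\<close>

context framework
begin

lemma edges_C_subset: "C \<in> \<C> \<Longrightarrow> edges C \<subseteq> edges G - edges F"
  using subgraph_C by (auto simp: subgraph_def delete_edges_def)

lemma verts_C: "C \<in> \<C> \<Longrightarrow> e \<in> edges C \<Longrightarrow> v \<in> e \<Longrightarrow> v \<in> verts C"
  using subgraph_C[of C] unfolding subgraph_def simple_graph_def by blast

lemma edgeE:
  assumes "e \<in> edges G" "v \<in> e"
  obtains u where "e = {u, v}" "u \<noteq> v"
proof -
  obtain x y where "e = {x, y}" "x \<noteq> y"
    using assms(1) simple_G by (auto simp: simple_graph_def card_2_iff)
  then show ?thesis using that[of x] that[of y] assms(2) by auto
qed

lemma finite_edges: "finite (edges G)"
proof -
  have "edges G \<subseteq> Pow (verts G)" using simple_G by (auto simp: simple_graph_def)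
  then show ?thesis using finite_G by (meson finite_Pow_iff finite_subset)
qed

lemma degree_G: "e \<in> edges G \<Longrightarrow> v \<in> e \<Longrightarrow> card {d \<in> edges G. v \<in> d} = 3"
  using cubic_G simple_G by (fastforce simp: cubic_def degree_def simple_graph_def)

lemma not_in_verts_F: "v \<notin> verts F \<Longrightarrow> v \<in> d \<Longrightarrow> d \<notin> edges F"
  using subgraph_F by (auto simp: subgraph_def simple_graph_def)

text \<open>No edge of \<open>F\<close> is incident with \<open>v\<close>, so nothing is lost there;
  uniqueness (3) therefore applies at every vertex of an edge that is outside
  \<open>V(F)\<close>.\<close>

lemma degree_delete:
  assumes "v \<notin> verts F"
  shows "degree (delete_edges G (edges F)) v = card {d \<in> edges G. v \<in> d}"
  using not_in_verts_F[OF assms]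
  by (auto simp: degree_def delete_edges_def intro!: arg_cong[where f = card])

lemma degree_C_le:
  assumes "C \<in> \<C>" shows "card {d \<in> edges C. v \<in> d} \<le> 2"
  using F1[OF assms] path_degree_le[of C v] circuit_degree_le[of C v] by blast

text \<open>(F5) makes \<open>v\<close> an end of the path \<open>C\<close>.\<close>

lemma path_in_F_not_continues:
  assumes "C \<in> \<C>" "is_path C" "e \<in> edges C" "v \<in> e" "v \<in> verts F"
  shows "\<not> continues_past C e v"
proof -
  have "v \<in> verts (graph_inter C F)"
    using assms verts_C by (simp add: graph_inter_def)
  then have "v \<in> path_ends C" using F5_path[OF assms(1,2)] by blast
  then show ?thesis using path_end_not_continues assms(3,4) by metis
qed

lemma edge_in_F:
  assumes "e \<in> edges G" "e \<subseteq> verts F"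
  shows "e \<in> edges F"
proof (rule ccontr)
  assume "e \<notin> edges F"
  then obtain C where C: "C \<in> \<C>" "e \<in> edges C"
    using F2_cover[of e] assms by (auto simp: delete_edges_def)
  obtain u v where e: "e = {u, v}" "u \<noteq> v"
    using simple_G assms(1) by (auto simp: simple_graph_def card_2_iff)
  show False
  proof (cases "is_circuit C")
    case True
    have sub: "{u, v} \<subseteq> verts (graph_inter C F)"
      using verts_C[OF C] assms(2) e by (auto simp: graph_inter_def)
    have "finite (verts F)" using subgraph_F finite_G
      by (auto simp: subgraph_def intro: finite_subset)
    then have "finite (verts (graph_inter C F))" by (simp add: graph_inter_def)
    then have "2 \<le> card (verts (graph_inter C F))"
      using card_mono[OF _ sub] e(2) by simp
    then show False using F5_circuit[OF C(1) True] by simp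
  next
    case False
    then have "is_path C" "card (edges C) \<ge> 3" using F1[OF C(1)] by auto
    \<comment> \<open>The path would stop at both \<open>u\<close> and \<open>v\<close>, which at
      least three edges forbid.\<close>
    then show False
      using path_in_F_not_continues[OF C(1) _ C(2)] path_continues_some[of C u v] C e assms(2)
      by auto
  qed
qed

lemma adjacent_member_unique:
  assumes "v \<in> e" "v \<in> f" "e \<noteq> f" "e \<in> edges G" "f \<in> edges G"
    and deg: "degree (delete_edges G (edges F)) v = 3"
    and C: "C1 \<in> \<C>" "e \<in> edges C1" "f \<in> edges C1" "C2 \<in> \<C>" "e \<in> edges C2" "f \<in> edges C2"
  shows "C1 = C2"
proof (rule ccontr)
  assume "C1 \<noteq> C2"
  then have tw: "twinned \<C> e f"
    using C assms(3) by (auto simp: twinned_def graph_inter_def)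
  have n: "card (edges C1) \<ge> 3" using F1 C(1) by blast
  obtain u where e: "e = {u, v}" "u \<noteq> v" using edgeE assms(1,4) by blast
  obtain w where f: "f = {w, v}" "w \<noteq> v" using edgeE assms(2,5) by blast
  \<comment> \<open>The third alternative of (F6) is out because \<open>f\<close> lies in
    \<open>C1\<close>.\<close>
  consider "is_circuit C1" "\<exists>v\<in>verts F. v \<in> e \<and> v \<in> f"
    | "is_path C1" "end_edges C1 = {e, f}"
    using F6[OF tw C(1,2)] C(3) by blast
  then show False
  proof cases
    case 1
    \<comment> \<open>(F6) only names some common end in \<open>V(F)\<close>; distinct edges share
      at most one vertex, so it is \<open>v\<close>.\<close>
    have "v \<in> verts F" using 1(2) e f assms(3) by (auto simp: doubleton_eq_iff)
    then have "degree F v = 1"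
      using F5_circuit[OF C(1) 1(1)] verts_C[OF C(1,2)] assms(1) by (auto simp: graph_inter_def)
    then obtain d where d: "{d \<in> edges F. v \<in> d} = {d}"
      unfolding degree_def by (metis One_nat_def card_1_singletonE)
    \<comment> \<open>One of the three edges of \<open>G\<close> at \<open>v\<close> belongs to
      \<open>F\<close>, so fewer than three survive the deletion, against
      \<open>deg\<close>.\<close>
    have "{d \<in> edges G - edges F. v \<in> d} \<subseteq> {d \<in> edges G. v \<in> d} - {d}"
      using d by auto
    moreover have "d \<in> {d \<in> edges G. v \<in> d}"
      using d subgraph_F by (auto simp: subgraph_def)
    ultimately have "card {d \<in> edges G - edges F. v \<in> d} < card {d \<in> edges G. v \<in> d}"
      using finite_edges by (intro psubset_card_mono) auto
    then show False
      using deg degree_G[OF assms(4,1)] by (simp add: degree_def delete_edges_def)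
  next
    case 2
    show False using end_edges_disjoint[OF 2 n] assms(1,2) by blast
  qed
qed

text \<open>Each of the other two edges \<open>f1\<close>, \<open>f2\<close> at \<open>v\<close>
  lies with \<open>e\<close> in a member by (F2), and in only one by uniqueness. Every member
  continuing past \<open>v\<close> uses \<open>f1\<close> or \<open>f2\<close>.\<close>

lemma card_continuing_members:
  assumes e: "e \<in> edges G" and v: "v \<in> e" "v \<notin> verts F"
  shows "card {C \<in> \<C>. e \<in> edges C \<and> continues_past C e v} = 2"
proof -
  have deg: "card {d \<in> edges G. v \<in> d} = 3" using degree_G[OF e v(1)] .
  then have "card ({d \<in> edges G. v \<in> d} - {e}) = 2"
    using e v by (subst card_Diff_singleton) auto
  then obtain f1 f2 where f: "{d \<in> edges G. v \<in> d} - {e} = {f1, f2}" "f1 \<noteq> f2"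
    by (auto simp: card_2_iff)
  then have f12: "f1 \<in> edges G" "f2 \<in> edges G" "v \<in> f1" "v \<in> f2" "e \<noteq> f1" "e \<noteq> f2" by auto
  obtain C1 where C1: "C1 \<in> \<C>" "e \<in> edges C1" "f1 \<in> edges C1"
    using F2_adjacent[of e f1 v] e v f12 by blast
  obtain C2 where C2: "C2 \<in> \<C>" "e \<in> edges C2" "f2 \<in> edges C2"
    using F2_adjacent[of e f2 v] e v f12 by blast
  \<comment> \<open>A common member would have three edges at \<open>v\<close>, but paths and
    circuits have degree at most two.\<close>
  have "C1 \<noteq> C2"
  proof
    assume "C1 = C2"
    then have "{e, f1, f2} \<subseteq> {d \<in> edges C1. v \<in> d}" using C1 C2 f12 v by auto
    moreover have "finite {d \<in> edges C1. v \<in> d}"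
      using finite_edges edges_C_subset[OF C1(1)] by (auto intro: finite_subset)
    ultimately have "3 \<le> card {d \<in> edges C1. v \<in> d}"
      using card_mono[of "{d \<in> edges C1. v \<in> d}" "{e, f1, f2}"] f(2) f12 by auto
    then show False using degree_C_le[OF C1(1), of v] by simp
  qed
  moreover have "{C \<in> \<C>. e \<in> edges C \<and> continues_past C e v} = {C1, C2}"
  proof (intro equalityI subsetI)
    fix C assume "C \<in> {C \<in> \<C>. e \<in> edges C \<and> continues_past C e v}"
    then obtain d where C: "C \<in> \<C>" "e \<in> edges C" "d \<in> edges C" "d \<noteq> e" "v \<in> d"
      by (auto simp: continues_past_def)
    have "d \<in> {f1, f2}" using C edges_C_subset[OF C(1)] f(1) by blast
    then have "d = f1 \<or> d = f2" by simp
    \<comment> \<open>Used with \<open>D\<close> equal to \<open>C1\<close> or \<open>C2\<close>,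
      according to which of \<open>f1\<close>, \<open>f2\<close> is \<open>d\<close>.\<close>
    moreover have "C = D" if "D \<in> \<C>" "e \<in> edges D" "d \<in> edges D" for D
    proof (rule adjacent_member_unique[of v e d])
      show "d \<in> edges G" using C edges_C_subset[OF C(1)] by blast
      show "degree (delete_edges G (edges F)) v = 3" using degree_delete[OF v(2)] deg by simp
    qed (use C e v that in simp_all)
    ultimately show "C \<in> {C1, C2}" using C1 C2 by blast
  qed (use C1 C2 f12 in \<open>auto simp: continues_past_def\<close>)
  ultimately show ?thesis by simp
qed

text \<open>(F4) turns every member containing \<open>e\<close> into a path. A second member
  \<open>D\<close>, supplied by \<open>two\<close>, shares \<open>e\<close> with \<open>C\<close>,
  and then (F4) for this pair makes \<open>e\<close> an end-edge of \<open>C\<close>.\<close>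

lemma end_edge_of_all:
  assumes "P \<in> \<C>" "is_path P" "e \<in> end_edges P"
    and "C \<in> \<C>" "e \<in> edges C"
    and two: "card {C \<in> \<C>. e \<in> edges C} \<ge> 2"
  shows "is_path C \<and> e \<in> end_edges C"
proof -
  have p: "is_path D" if "D \<in> \<C>" "e \<in> edges D" for D
    using F4_end_edge assms(1-3) that by blast
  have "\<not> {C \<in> \<C>. e \<in> edges C} \<subseteq> {C}"
    using two card_mono[of "{C}" "{C \<in> \<C>. e \<in> edges C}"] by auto
  then obtain D where "D \<in> \<C>" "e \<in> edges D" "D \<noteq> C" by blast
  then show ?thesis
    using F4_inter[of C D] p assms(4,5) by (auto simp: graph_inter_def)
qed

lemma card_members:
  assumes e: "e \<in> edges G - edges F"
  shows "card {C \<in> \<C>. e \<in> edges C} =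
    (if (\<exists>P\<in>\<C>. is_path P \<and> e \<in> end_edges P) \<and> e \<inter> verts F = {} then 4 else 2)"
    and "card {C \<in> \<C>. e \<in> edges C} \<ge> 2"
proof -
  let ?M = "{C \<in> \<C>. e \<in> edges C}"
  let ?N = "\<lambda>v. {C \<in> \<C>. e \<in> edges C \<and> continues_past C e v}"
  \<comment> \<open>Since \<open>e\<close> is not in \<open>F\<close>, part (1) gives it an end
    outside \<open>V(F)\<close>.\<close>
  obtain v where v: "v \<in> e" "v \<notin> verts F" using edge_in_F e by blast
  obtain u where u: "e = {u, v}" "u \<noteq> v" using edgeE e v by blast
  have Nv: "card (?N v) = 2" using card_continuing_members e v by blast
  have cases: "is_circuit C \<or> is_path C" "card (edges C) \<ge> 3" if "C \<in> \<C>" for C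
    using F1 that by blast+
  have some: "continues_past C e u \<or> continues_past C e v" if "C \<in> ?M" for C
    using that cases[of C] path_continues_some[of C u v] circuit_continues[of C e v] u by auto
  have "?M = ?N u \<union> ?N v" using some by auto
  show *: "card ?M = (if (\<exists>P\<in>\<C>. is_path P \<and> e \<in> end_edges P) \<and> e \<inter> verts F = {} then 4 else 2)"
  proof (cases "(\<exists>P\<in>\<C>. is_path P \<and> e \<in> end_edges P) \<and> e \<inter> verts F = {}")
    case True
    then obtain P where P: "P \<in> \<C>" "is_path P" "e \<in> end_edges P" by blast
    have Nu: "card (?N u) = 2" using card_continuing_members[of e u] e u True by blast
    \<comment> \<open>Infinite sets have \<open>card\<close> 0, so the counts just found already
      yield finiteness.\<close>
    have fin: "finite (?N u)" "finite (?N v)"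
      using Nu Nv by (auto intro: card_ge_0_finite)
    have "finite ?M" using fin \<open>?M = ?N u \<union> ?N v\<close> by simp
    \<comment> \<open>This bound must come before the exact count, since
      \<open>end_edge_of_all\<close> relies on it.\<close>
    then have "card ?M \<ge> 2" using Nv card_mono[of ?M "?N v"] by auto
    then have "e \<in> end_edges C" if "C \<in> \<C>" "e \<in> edges C" for C
      using end_edge_of_all[OF P that] by simp
    then have "\<not> (continues_past C e u \<and> continues_past C e v)" if "C \<in> \<C>" "e \<in> edges C" for C
      using end_edge_not_continues_both[of u v C] cases(2) that unfolding u(1) by metis
    then have "?N u \<inter> ?N v = {}" by blast
    then have "card ?M = 4"
      using card_Un_disjoint[OF fin] Nu Nv \<open>?M = ?N u \<union> ?N v\<close> by simp
    then show ?thesis using True by simp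
  next
    case False
    have "continues_past C e v" if C: "C \<in> \<C>" "e \<in> edges C" for C
    proof (cases "is_circuit C \<or> e \<notin> end_edges C")
      case True
      then consider "is_circuit C" | "is_path C" "e \<notin> end_edges C" using cases(1)[OF C(1)] by blast
      then show ?thesis
        by cases (fact circuit_continues[OF _ C(2) v(1)], fact path_continues[OF _ C(2) _ v(1)])
    next
      case nc: False
      then have "is_path C" using cases C by blast
      \<comment> \<open>Here \<open>C\<close> is a path with end-edge \<open>e\<close>, so what
        fails is \<open>e \<inter> verts F = {}\<close>; as \<open>v\<close> is outside
        \<open>V(F)\<close>, the vertex inside is \<open>u\<close>. Hence \<open>C\<close> stops at
        \<open>u\<close> and must continue past \<open>v\<close>.\<close>
      then have "u \<in> verts F" using False nc C u v(2) by auto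
      then have "\<not> continues_past C e u"
        using path_in_F_not_continues[OF C(1) \<open>is_path C\<close> C(2)] u by auto
      then show ?thesis using some C by blast
    qed
    then have "?M = ?N v" by blast
    then show ?thesis using Nv False by auto
  qed
  then show "card ?M \<ge> 2" by simp
qed

end

theorem theorem3p1:
  fixes G F :: "'a graph" and \<C> :: "'a graph set"
  assumes "framework G F \<C>"
  shows "induced_subgraph F G \<and>
    (\<forall>e \<in> edges G - edges F.
       card {C \<in> \<C>. e \<in> edges C} \<ge> 2 \<and>
       (card {C \<in> \<C>. e \<in> edges C} > 2 \<longleftrightarrow>
          (\<exists>P\<in>\<C>. is_path P \<and> e \<in> end_edges P) \<and> e \<inter> verts F = {}) \<and>
       (card {C \<in> \<C>. e \<in> edges C} > 2 \<longrightarrow>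
          card {C \<in> \<C>. e \<in> edges C} = 4 \<and>
          (\<forall>C\<in>\<C>. e \<in> edges C \<longrightarrow> is_path C \<and> e \<in> end_edges C))) \<and>
    (\<forall>e\<in>edges G. \<forall>f\<in>edges G. \<forall>v. e \<noteq> f \<and> v \<in> e \<inter> f \<and>
       degree (delete_edges G (edges F)) v = 3 \<longrightarrow>
       (\<exists>\<^sub>\<le>\<^sub>1 C. C \<in> \<C> \<and> e \<in> edges C \<and> f \<in> edges C))"
proof -
  interpret framework G F \<C> by fact
  show ?thesis
  proof (intro conjI ballI allI impI)
    show "induced_subgraph F G"
      using subgraph_F edge_in_F by (auto simp: induced_subgraph_def)
  next
    fix e f v
    assume "e \<in> edges G" "f \<in> edges G" "e \<noteq> f \<and> v \<in> e \<inter> f \<and>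
       degree (delete_edges G (edges F)) v = 3"
    then show "\<exists>\<^sub>\<le>\<^sub>1 C. C \<in> \<C> \<and> e \<in> edges C \<and> f \<in> edges C"
      using adjacent_member_unique[of v e f] unfolding Uniq_def by blast
  next
    fix e assume e: "e \<in> edges G - edges F"
    note card = card_members[OF e]
    show "card {C \<in> \<C>. e \<in> edges C} \<ge> 2" by (fact card(2))
    show "card {C \<in> \<C>. e \<in> edges C} > 2 \<longleftrightarrow>
          (\<exists>P\<in>\<C>. is_path P \<and> e \<in> end_edges P) \<and> e \<inter> verts F = {}"
      \<comment> \<open>The count is 4 under the stated condition and 2 otherwise, so exceeding 2 is
        equivalent to the condition.\<close>
      unfolding card(1) by simp
    assume gt: "card {C \<in> \<C>. e \<in> edges C} > 2"
    then show "card {C \<in> \<C>. e \<in> edges C} = 4"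
      unfolding card(1) by (simp split: if_splits)
    from gt obtain P where "P \<in> \<C>" "is_path P" "e \<in> end_edges P"
      unfolding card(1) by (auto split: if_splits)
    note all = end_edge_of_all[OF this _ _ card(2)]
    fix C assume "C \<in> \<C>" "e \<in> edges C"
    then show "is_path C" "e \<in> end_edges C" using all by blast+
  qed
qed

end
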